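(* Let $\{V_n\}_{n\in\mathbb N}$, $\{G_n\}_{n\in\mathbb N}$ be the sequences of matrix biorthogonal polynomials with respect to a quasidefinite $N\times N$ matrix of measures $W$, satisfying for $n\in\mathbb N$ $$x\,V_n(x)=A_n V_{n+1}(x)+B_nV_n(x)+C_nV_{n-1}(x),\qquad x\,G_n(x)=G_{n-1}(x)A_{n-1}+G_n(x)B_n+G_{n+1}(x)C_{n+1},$$ with $V_{-1}=G_{-1}=\mathbf 0_N$, $V_0=G_0=I_N$, where $A_n$, $C_n$ are nonsingular, and let $\{V_n^{(1)}\}_{n\in\mathbb N}$, $\{G_n^{(1)}\}_{n\in\mathbb N}$ be, respectively, their first kind associated polynomial sequences. Then for every $n\in\mathbb N$ $$V_n^{(1)}(x)\,G_n(x)-V_{n+1}(x)\,G_{n-1}^{(1)}(x)=A_n^{-1},$$ $$V_n(x)\,G_n^{(1)}(x)-V_{n-1}^{(1)}(x)\,G_{n+1}(x)=C_{n+1}^{-1}.$$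
   Context: $N\ge1$ is fixed, $\mathbb N=\{0,1,2,\dots\}$, $I_N$ and $\mathbf 0_N$ are the $N\times N$ identity and zero matrices. A quasidefinite $N\times N$ matrix of measures is a matrix $W=(w_{i,j})_{i,j=0}^{N-1}$ of measures supported on the real line ($W$ is not necessarily positive definite) with finite moments $U_n=\int x^n\,dW(x)$ such that $\det\bigl((U_{i+j})_{i,j=0}^{n}\bigr)\ne0$ for all $n\in\mathbb N$; it is normalized by $U_0=I_N$. Sequences of matrix polynomials $\{V_n\},\{G_n\}\subset\mathbb C^{N\times N}[x]$ with $\deg V_n=\deg G_n=n$ are biorthogonal with respect to $W$ if $\int V_n(x)\,dW(x)\,x^m=\Omega_n^{(1)}\delta_{n,m}$ and $\int x^m\,dW(x)\,G_n(x)=\Omega_n^{(2)}\delta_{n,m}$ for $m=0,\dots,n$, with $\Omega_n^{(1)},\Omega_n^{(2)}$ nonsingular, and $\int V_n(x)\,dW(x)\,G_m(x)=I_N\delta_{n,m}$ for all $n,m\in\mathbb N$. The first kind associated polynomials are $V_{n-1}^{(1)}(x)=\int\frac{V_n(x)-V_n(y)}{x-y}\,dW(y)$ and $G_{n-1}^{(1)}(x)=\int dW(y)\,\frac{G_n(x)-G_n(y)}{x-y}$; in particular $V_{-1}^{(1)}=G_{-1}^{(1)}=\mathbf 0_N$, $V_0^{(1)}=A_0^{-1}$, $G_0^{(1)}=C_1^{-1}$. *)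

theory Defs
  imports
    "HOL-Analysis.Bochner_Integration"
    "Jordan_Normal_Form.Gauss_Jordan_Elimination"
    "Jordan_Normal_Form.Determinant"
begin

section \<open>Complex measures on the real line\<close>

text \<open>
  The measures in a matrix of measures need not be positive. A (finite) signed or complex Borel
  measure on the real line is a countably additive set function on the Borel sets; its values
  outside the Borel sets are irrelevant.
\<close>

definition set_measure :: "(real set \<Rightarrow> 'a::real_normed_vector) \<Rightarrow> bool" where
  "set_measure \<mu> \<longleftrightarrow>
     (\<forall>S. range S \<subseteq> sets borel \<and> disjoint_family S \<longrightarrow> (\<lambda>k::nat. \<mu> (S k)) sums \<mu> (\<Union>k. S k))"

text \<open>
  The positive part of the Jordan decomposition of a signed measure \<open>\<nu>\<close>; the negative part is the
  positive part of \<open>- \<nu>\<close>. Negative values of \<open>\<nu>\<close> are clipped by \<^const>\<open>ennreal\<close>, which is harmless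
  since \<open>T = {}\<close> is admitted in the supremum.
\<close>

definition positive_part :: "(real set \<Rightarrow> real) \<Rightarrow> real measure" where
  "positive_part \<nu> =
     measure_of UNIV (sets borel) (\<lambda>S. SUP T \<in> {T \<in> sets borel. T \<subseteq> S}. ennreal (\<nu> T))"

abbreviation negative_part :: "(real set \<Rightarrow> real) \<Rightarrow> real measure" where
  "negative_part \<nu> \<equiv> positive_part (\<lambda>S. - \<nu> S)"

definition signed_integrable :: "(real set \<Rightarrow> real) \<Rightarrow> (real \<Rightarrow> complex) \<Rightarrow> bool" where
  "signed_integrable \<nu> f \<longleftrightarrow> integrable (positive_part \<nu>) f \<and> integrable (negative_part \<nu>) f"

definition signed_integral :: "(real set \<Rightarrow> real) \<Rightarrow> (real \<Rightarrow> complex) \<Rightarrow> complex" where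
  "signed_integral \<nu> f = integral\<^sup>L (positive_part \<nu>) f - integral\<^sup>L (negative_part \<nu>) f"

definition complex_integrable :: "(real set \<Rightarrow> complex) \<Rightarrow> (real \<Rightarrow> complex) \<Rightarrow> bool" where
  "complex_integrable \<mu> f \<longleftrightarrow>
     signed_integrable (\<lambda>S. Re (\<mu> S)) f \<and> signed_integrable (\<lambda>S. Im (\<mu> S)) f"

definition complex_integral :: "(real set \<Rightarrow> complex) \<Rightarrow> (real \<Rightarrow> complex) \<Rightarrow> complex" where
  "complex_integral \<mu> f =
     signed_integral (\<lambda>S. Re (\<mu> S)) f + \<i> * signed_integral (\<lambda>S. Im (\<mu> S)) f"

text \<open>
  The following facts confirm that \<^const>\<open>positive_part\<close> really is the measure given by the
  supremum (so that \<^const>\<open>measure_of\<close> does not degenerate to the zero measure), and that the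
  integral recovers the set function.
\<close>

lemma space_positive_part [simp]: "space (positive_part \<nu>) = UNIV"
  by (simp add: positive_part_def space_measure_of_conv)

lemma sets_positive_part [simp, measurable_cong]: "sets (positive_part \<nu>) = sets borel"
  unfolding positive_part_def
  by (metis sets.sigma_sets_eq sets_measure_of space_borel subset_UNIV Pow_UNIV)

lemma set_measure_empty:
  assumes "set_measure \<mu>" shows "\<mu> {} = 0"
proof -
  have "(\<lambda>k::nat. \<mu> {}) sums \<mu> {}"
    using assms unfolding set_measure_def disjoint_family_on_def
    by (drule_tac spec[of _ "\<lambda>_. {}"]) auto
  then have "(\<lambda>k::nat. \<mu> {}) \<longlonglongrightarrow> 0"
    using summable_LIMSEQ_zero sums_summable by blast
  then show ?thesis by (simp add: LIMSEQ_const_iff)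
qed

lemma set_measure_Un:
  assumes m: "set_measure \<mu>" and A: "A \<in> sets borel" and B: "B \<in> sets borel" and d: "A \<inter> B = {}"
  shows "\<mu> (A \<union> B) = \<mu> A + \<mu> B"
proof -
  have "range (binaryset A B) \<subseteq> sets borel" "disjoint_family (binaryset A B)"
    using A B d by (auto simp: binaryset_def disjoint_family_on_def)
  then have "(\<lambda>k. \<mu> (binaryset A B k)) sums \<mu> (\<Union>k. binaryset A B k)"
    using m unfolding set_measure_def by blast
  then have "(\<lambda>k. \<mu> (binaryset A B k)) sums \<mu> (A \<union> B)"
    by (simp add: UN_binaryset_eq)
  moreover have "(\<lambda>k. \<mu> (binaryset A B k)) sums (\<mu> A + \<mu> B)"
    using binaryset_sums[of \<mu> A B] set_measure_empty[OF m] by blast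
  ultimately show ?thesis using sums_unique2 by blast
qed

lemma SUP_add_le:
  fixes f g :: "'a \<Rightarrow> ennreal"
  assumes "I \<noteq> {}" "J \<noteq> {}" and le: "\<And>i j. i \<in> I \<Longrightarrow> j \<in> J \<Longrightarrow> f i + g j \<le> c"
  shows "(SUP i\<in>I. f i) + (SUP j\<in>J. g j) \<le> c"
proof -
  have "(SUP i\<in>I. f i) + (SUP j\<in>J. g j) = (SUP i\<in>I. f i + (SUP j\<in>J. g j))"
    using ennreal_SUP_add_left[OF \<open>I \<noteq> {}\<close>, of f "SUP j\<in>J. g j"] by simp
  also have "\<dots> \<le> c"
  proof (rule SUP_least)
    fix i assume "i \<in> I"
    have "f i + (SUP j\<in>J. g j) = (SUP j\<in>J. f i + g j)"
      using ennreal_SUP_add_right[OF \<open>J \<noteq> {}\<close>, of "f i" g] by simp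
    also have "\<dots> \<le> c" using le[OF \<open>i \<in> I\<close>] by (rule SUP_least)
    finally show "f i + (SUP j\<in>J. g j) \<le> c" .
  qed
  finally show ?thesis .
qed

lemma emeasure_positive_part:
  assumes m: "set_measure \<nu>" and S: "S \<in> sets borel"
  shows "emeasure (positive_part \<nu>) S = (SUP T \<in> {T \<in> sets borel. T \<subseteq> S}. ennreal (\<nu> T))"
    (is "_ = ?P S")
proof (rule emeasure_measure_of[OF positive_part_def])
  show "sets borel \<subseteq> Pow UNIV" by simp
  show "S \<in> sets (positive_part \<nu>)" using S by simp
  show "positive (sets (positive_part \<nu>)) ?P"
    unfolding positive_def
    by (auto simp: set_measure_empty[OF m] bot_ennreal intro!: antisym SUP_least)
  show "countably_additive (sets (positive_part \<nu>)) ?P"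
    unfolding countably_additive_def
  proof (intro allI impI, rule antisym)
    fix D :: "nat \<Rightarrow> real set"
    assume "range D \<subseteq> sets (positive_part \<nu>)" and d: "disjoint_family D"
    then have D: "D k \<in> sets borel" for k by auto
    show "?P (\<Union>k. D k) \<le> (\<Sum>k. ?P (D k))"
    proof (rule SUP_least)
      fix T :: "real set" assume T: "T \<in> {T \<in> sets borel. T \<subseteq> (\<Union>k. D k)}"
      have s: "(\<lambda>k. \<nu> (T \<inter> D k)) sums \<nu> T"
      proof -
        have "(\<Union>k. T \<inter> D k) = T" using T by auto
        moreover have "disjoint_family (\<lambda>k. T \<inter> D k)"
          using d by (auto simp: disjoint_family_on_def)
        moreover have "range (\<lambda>k. T \<inter> D k) \<subseteq> sets borel" using D T by auto
        ultimately show ?thesis using m unfolding set_measure_def by metis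
      qed
      have "(\<lambda>n. ennreal (\<Sum>k<n. \<nu> (T \<inter> D k))) \<longlonglongrightarrow> ennreal (\<nu> T)"
        using s unfolding sums_def by (rule tendsto_ennrealI)
      then show "ennreal (\<nu> T) \<le> (\<Sum>k. ?P (D k))"
      proof (rule LIMSEQ_le_const2, intro exI allI impI)
        fix n
        have "ennreal (\<Sum>k<n. \<nu> (T \<inter> D k)) \<le> ennreal (\<Sum>k<n. max 0 (\<nu> (T \<inter> D k)))"
          by (intro ennreal_leI sum_mono) auto
        also have "\<dots> = (\<Sum>k<n. ennreal (max 0 (\<nu> (T \<inter> D k))))"
          by (subst sum_ennreal) auto
        also have "\<dots> \<le> (\<Sum>k<n. ?P (D k))"
        proof (rule sum_mono)
          fix k
          have "ennreal (max 0 (\<nu> (T \<inter> D k))) = ennreal (\<nu> (T \<inter> D k))"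
            by (auto simp: max_def ennreal_neg)
          also have "\<dots> \<le> ?P (D k)"
            using T D by (intro SUP_upper) auto
          finally show "ennreal (max 0 (\<nu> (T \<inter> D k))) \<le> ?P (D k)" .
        qed
        also have "\<dots> \<le> (\<Sum>k. ?P (D k))" by (rule sum_le_suminf) auto
        finally show "ennreal (\<Sum>k<n. \<nu> (T \<inter> D k)) \<le> (\<Sum>k. ?P (D k))" .
      qed
    qed
    have fin: "(\<Sum>k<n. ?P (D k)) \<le> ?P (\<Union>k<n. D k)" for n
    proof (induction n)
      case (Suc n)
      let ?E = "\<Union>k<n. D k"
      have "?P ?E + ?P (D n) \<le> ?P (?E \<union> D n)"
      proof (rule SUP_add_le)
        show "{T \<in> sets borel. T \<subseteq> ?E} \<noteq> {}" "{T \<in> sets borel. T \<subseteq> D n} \<noteq> {}"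
          by (auto intro: exI[of _ "{}"])
        fix T U :: "real set"
        assume T: "T \<in> {T \<in> sets borel. T \<subseteq> ?E}" and U: "U \<in> {T \<in> sets borel. T \<subseteq> D n}"
        have "D k \<inter> D n = {}" if "k < n" for k
          using d that unfolding disjoint_family_on_def by auto
        then have e: "?E \<inter> D n = {}" by blast
        have TU: "\<nu> (T \<union> U) = \<nu> T + \<nu> U"
          by (rule set_measure_Un[OF m]) (use T U e in auto)
        have 1: "ennreal (\<nu> R) \<le> ?P (?E \<union> D n)" if "R \<in> {T, U, T \<union> U}" for R
          using that T U by (intro SUP_upper) auto
        show "ennreal (\<nu> T) + ennreal (\<nu> U) \<le> ?P (?E \<union> D n)"
        proof (cases "\<nu> T \<ge> 0 \<and> \<nu> U \<ge> 0")
          case True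
          then show ?thesis using 1[of "T \<union> U"] TU by (simp add: ennreal_plus)
        next
          case False
          then consider "ennreal (\<nu> T) = 0" | "ennreal (\<nu> U) = 0"
            by (meson ennreal_neg linear)
          then show ?thesis using 1[of T] 1[of U] by cases auto
        qed
      qed
      moreover have "(\<Union>k<Suc n. D k) = ?E \<union> D n" by (auto simp: less_Suc_eq)
      ultimately have "?P ?E + ?P (D n) \<le> ?P (\<Union>k<Suc n. D k)" by simp
      from order_trans[OF add_right_mono[OF Suc] this] show ?case by simp
    qed simp
    show "(\<Sum>k. ?P (D k)) \<le> ?P (\<Union>k. D k)"
    proof (rule suminf_le_const)
      show "summable (\<lambda>k. ?P (D k))" by simp
      fix n
      have "?P (\<Union>k<n. D k) \<le> ?P (\<Union>k. D k)" by (rule SUP_subset_mono) auto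
      then show "(\<Sum>k<n. ?P (D k)) \<le> ?P (\<Union>k. D k)" using fin[of n] by order
    qed
  qed
qed

lemma jordan_decomposition:
  assumes m: "set_measure \<nu>" and S: "S \<in> sets borel"
  shows "emeasure (positive_part \<nu>) S + ennreal (- \<nu> S)
       = emeasure (negative_part \<nu>) S + ennreal (\<nu> S)"
proof -
  have le: "emeasure (positive_part \<nu>) S + ennreal (- \<nu> S) \<le> emeasure (negative_part \<nu>) S + ennreal (\<nu> S)"
    if m: "set_measure \<nu>" for \<nu>
  proof -
    have m': "set_measure (\<lambda>S. - \<nu> S)"
      using m unfolding set_measure_def by (auto intro: sums_minus)
    have "ennreal (\<nu> T) + ennreal (- \<nu> S) \<le> emeasure (negative_part \<nu>) S + ennreal (\<nu> S)"
      if T: "T \<in> {T \<in> sets borel. T \<subseteq> S}" for T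
    proof -
      have split: "\<nu> S = \<nu> T + \<nu> (S - T)"
        using set_measure_Un[OF m, of T "S - T"] T S by (simp add: Un_absorb1)
      have up: "ennreal (- \<nu> R) \<le> emeasure (negative_part \<nu>) S" if "R \<in> {S - T, S}" for R
        unfolding emeasure_positive_part[OF m' S] using that T S by (intro SUP_upper) auto
      have "ennreal (\<nu> T) + ennreal (- \<nu> S) \<le> ennreal (max 0 (max (- \<nu> (S - T)) (- \<nu> S))) + ennreal (\<nu> S)"
      proof -
        have mx: "ennreal r = ennreal (max 0 r)" for r
          by (auto simp: max_def ennreal_neg)
        have "max 0 (\<nu> T) + max 0 (- \<nu> S) \<le> max 0 (max (- \<nu> (S - T)) (- \<nu> S)) + max 0 (\<nu> S)"
          using split by linarith
        from ennreal_leI[OF this] have "ennreal (max 0 (\<nu> T)) + ennreal (max 0 (- \<nu> S))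
            \<le> ennreal (max 0 (max (- \<nu> (S - T)) (- \<nu> S))) + ennreal (max 0 (\<nu> S))"
          by (subst (asm) (1 2) ennreal_plus) auto
        then show ?thesis by (simp flip: mx)
      qed
      also have "ennreal (max 0 (max (- \<nu> (S - T)) (- \<nu> S))) \<le> emeasure (negative_part \<nu>) S"
        using up[of S] up[of "S - T"] by (auto simp: max_def)
      finally show ?thesis by (simp add: add_right_mono)
    qed
    then show ?thesis
      unfolding emeasure_positive_part[OF m S]
      by (subst ennreal_SUP_add_left[symmetric]) (auto intro!: SUP_least)
  qed
  have "set_measure (\<lambda>S. - \<nu> S)"
    using m unfolding set_measure_def by (auto intro: sums_minus)
  from le[OF m] le[OF this] show ?thesis by (simp add: antisym)
qed

lemma signed_integral_indicator:
  assumes m: "set_measure \<nu>" and S: "S \<in> sets borel" and fin: "signed_integrable \<nu> (\<lambda>_. 1)"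
  shows "signed_integral \<nu> (indicator S) = of_real (\<nu> S)"
proof -
  have f: "emeasure (positive_part \<nu>) UNIV < \<infinity>" "emeasure (negative_part \<nu>) UNIV < \<infinity>"
    using fin unfolding signed_integrable_def by (auto simp: integrable_iff_bounded)
  interpret p: finite_measure "positive_part \<nu>" by standard (use f in auto)
  interpret n: finite_measure "negative_part \<nu>" by standard (use f in auto)
  have "measure (positive_part \<nu>) S - measure (negative_part \<nu>) S = \<nu> S"
    using jordan_decomposition[OF m S]
    unfolding p.emeasure_eq_measure n.emeasure_eq_measure
    using measure_nonneg[of "positive_part \<nu>" S] measure_nonneg[of "negative_part \<nu>" S]
    by (cases "\<nu> S \<ge> 0") (auto simp: ennreal_neg simp flip: ennreal_plus)
  moreover have "integral\<^sup>L M (indicator S :: real \<Rightarrow> complex) = of_real (measure M S)"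
    if "space M = UNIV" for M
  proof -
    have "(indicator S :: real \<Rightarrow> complex) = (\<lambda>x. complex_of_real (indicator S x))"
      by (auto simp: indicator_def fun_eq_iff)
    then show ?thesis using integral_complex_of_real[of M "indicator S"] that by simp
  qed
  ultimately show ?thesis unfolding signed_integral_def by (simp flip: of_real_diff)
qed

lemma complex_integral_indicator:
  assumes m: "set_measure \<mu>" and S: "S \<in> sets borel" and fin: "complex_integrable \<mu> (\<lambda>_. 1)"
  shows "complex_integral \<mu> (indicator S) = \<mu> S"
proof -
  have "set_measure (\<lambda>S. Re (\<mu> S))" "set_measure (\<lambda>S. Im (\<mu> S))"
    using m unfolding set_measure_def by (auto intro: sums_Re sums_Im)
  then show ?thesis
    using fin S unfolding complex_integral_def complex_integrable_def
    by (simp add: signed_integral_indicator complex_eq_iff)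
qed

section \<open>Matrices of measures\<close>

text \<open>
  A matrix of measures of size \<open>N\<close> is a family \<open>W i j\<close> of set functions, of which only the entries
  with \<open>i, j < N\<close> matter.
\<close>

type_synonym measure_matrix = "nat \<Rightarrow> nat \<Rightarrow> real set \<Rightarrow> complex"

definition moment :: "nat \<Rightarrow> measure_matrix \<Rightarrow> nat \<Rightarrow> complex mat" where
  "moment N W n = mat N N (\<lambda>(i, j). complex_integral (W i j) (\<lambda>x. of_real x ^ n))"

definition block_hankel :: "nat \<Rightarrow> measure_matrix \<Rightarrow> nat \<Rightarrow> complex mat" where
  "block_hankel N W n = mat (Suc n * N) (Suc n * N)
     (\<lambda>(i, j). moment N W (i div N + j div N) $$ (i mod N, j mod N))"

definition quasidefinite :: "nat \<Rightarrow> measure_matrix \<Rightarrow> bool" where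
  "quasidefinite N W \<longleftrightarrow>
     (\<forall>i<N. \<forall>j<N. set_measure (W i j)) \<and>
     (\<forall>i<N. \<forall>j<N. \<forall>n. complex_integrable (W i j) (\<lambda>x. of_real x ^ n)) \<and>
     (\<forall>n. det (block_hankel N W n) \<noteq> 0)"

text \<open>The matrix integral of \<open>F(y) dW(y) H(y)\<close>, in this order of the factors.\<close>

definition matrix_integral ::
  "nat \<Rightarrow> measure_matrix \<Rightarrow> (real \<Rightarrow> complex mat) \<Rightarrow> (real \<Rightarrow> complex mat) \<Rightarrow> complex mat" where
  "matrix_integral N W F H = mat N N (\<lambda>(i, j).
     \<Sum>k<N. \<Sum>l<N. complex_integral (W k l) (\<lambda>y. F y $$ (i, k) * H y $$ (l, j)))"

section \<open>Matrix polynomials and biorthogonality\<close>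

text \<open>Matrix polynomials are matrices with polynomial entries.\<close>

definition eval_mat :: "complex poly mat \<Rightarrow> complex \<Rightarrow> complex mat" where
  "eval_mat P x = map_mat (\<lambda>p. poly p x) P"

definition mat_degree :: "complex poly mat \<Rightarrow> nat" where
  "mat_degree P = Max (degree ` elements_mat P)"

definition nonsingular :: "nat \<Rightarrow> complex mat \<Rightarrow> bool" where
  "nonsingular N A \<longleftrightarrow> A \<in> carrier_mat N N \<and> invertible_mat A"

definition inv_mat :: "complex mat \<Rightarrow> complex mat" where
  "inv_mat A = the (mat_inverse A)"

definition biorthogonal ::
  "nat \<Rightarrow> measure_matrix \<Rightarrow> (nat \<Rightarrow> complex poly mat) \<Rightarrow> (nat \<Rightarrow> complex poly mat) \<Rightarrow> bool" where
  "biorthogonal N W V G \<longleftrightarrow>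
     (\<forall>n. V n \<in> carrier_mat N N \<and> mat_degree (V n) = n) \<and>
     (\<forall>n. G n \<in> carrier_mat N N \<and> mat_degree (G n) = n) \<and>
     (\<exists>\<Omega>\<^sub>1. (\<forall>n. nonsingular N (\<Omega>\<^sub>1 n)) \<and>
       (\<forall>n. \<forall>m\<le>n. matrix_integral N W (\<lambda>y. eval_mat (V n) (of_real y)) (\<lambda>y. of_real y ^ m \<cdot>\<^sub>m 1\<^sub>m N)
                  = (if n = m then \<Omega>\<^sub>1 n else 0\<^sub>m N N))) \<and>
     (\<exists>\<Omega>\<^sub>2. (\<forall>n. nonsingular N (\<Omega>\<^sub>2 n)) \<and>
       (\<forall>n. \<forall>m\<le>n. matrix_integral N W (\<lambda>y. of_real y ^ m \<cdot>\<^sub>m 1\<^sub>m N) (\<lambda>y. eval_mat (G n) (of_real y))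
                  = (if n = m then \<Omega>\<^sub>2 n else 0\<^sub>m N N))) \<and>
     (\<forall>n m. matrix_integral N W (\<lambda>y. eval_mat (V n) (of_real y)) (\<lambda>y. eval_mat (G m) (of_real y))
          = (if n = m then 1\<^sub>m N else 0\<^sub>m N N))"

text \<open>\<open>prev N V n\<close> is \<open>V\<close> at index \<open>n - 1\<close>, with the convention that \<open>V\<close> vanishes at index \<open>-1\<close>.\<close>

definition prev :: "nat \<Rightarrow> (nat \<Rightarrow> complex poly mat) \<Rightarrow> nat \<Rightarrow> complex poly mat" where
  "prev N V n = (case n of 0 \<Rightarrow> 0\<^sub>m N N | Suc k \<Rightarrow> V k)"

section \<open>Associated polynomials of the first kind\<close>

text \<open>
  The quotient \<open>(p(x) - p(y)) / (x - y)\<close> is a polynomial in \<open>x\<close> and \<open>y\<close>; on the diagonal its value is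
  the derivative. The value there matters, since the measures may have an atom at \<open>x\<close>.
\<close>

definition diff_quotient :: "complex poly \<Rightarrow> complex \<Rightarrow> complex \<Rightarrow> complex" where
  "diff_quotient p x y = (if x = y then poly (pderiv p) x else (poly p x - poly p y) / (x - y))"

definition diff_quotient_mat :: "complex poly mat \<Rightarrow> complex \<Rightarrow> complex \<Rightarrow> complex mat" where
  "diff_quotient_mat P x y = map_mat (\<lambda>p. diff_quotient p x y) P"

text \<open>
  The associated polynomials lower the index by one: \<open>left_assoc N W V n\<close> is the polynomial with index
  \<open>n - 1\<close> associated with \<open>V n\<close>, and similarly for \<open>right_assoc\<close>. In particular the value at \<open>n = 0\<close>
  is the polynomial with index \<open>-1\<close>, which vanishes as \<open>V 0\<close> and \<open>G 0\<close> are constant.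
\<close>

definition left_assoc ::
  "nat \<Rightarrow> measure_matrix \<Rightarrow> (nat \<Rightarrow> complex poly mat) \<Rightarrow> nat \<Rightarrow> complex \<Rightarrow> complex mat" where
  "left_assoc N W V n x = matrix_integral N W (\<lambda>y. diff_quotient_mat (V n) x (of_real y)) (\<lambda>_. 1\<^sub>m N)"

definition right_assoc ::
  "nat \<Rightarrow> measure_matrix \<Rightarrow> (nat \<Rightarrow> complex poly mat) \<Rightarrow> nat \<Rightarrow> complex \<Rightarrow> complex mat" where
  "right_assoc N W G n x = matrix_integral N W (\<lambda>_. 1\<^sub>m N) (\<lambda>y. diff_quotient_mat (G n) x (of_real y))"

end

theory Submission
  imports Defs
begin

text \<open>
  The associated polynomials \<open>V'\<close> and \<open>G'\<close> satisfy the recurrences of \<open>V\<close> and \<open>G\<close>, up to an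
  inhomogeneous term at index \<open>0\<close> that is absorbed by a suitable initial value at index \<open>- 1\<close>.
  Hence \<open>w s t = V s * G' t - V' s * G t\<close> satisfies the recurrence of \<open>V\<close> in \<open>s\<close> and that of \<open>G\<close>
  in \<open>t\<close>. By simultaneous induction these force \<open>w\<close> to vanish on the diagonal and to be an inverse of
  a recurrence coefficient next to the diagonal. The vanishing on the diagonal is the step that needs
  both recurrences: \<open>A n * w (n + 1) (n + 1) * C (n + 1)\<close> is expanded in \<open>s\<close> and then in \<open>t\<close>, and
  both surviving terms equal \<open>x - B n\<close>.
\<close>

section \<open>Matrix three-term recurrences\<close>

lemma nonsingular_carrier: "nonsingular N M \<Longrightarrow> M \<in> carrier_mat N N"
  by (simp add: nonsingular_def)

lemma nonsingular_inverse:
  assumes "nonsingular N M"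
  obtains K where "K \<in> carrier_mat N N" "M * K = 1\<^sub>m N" "K * M = 1\<^sub>m N"
proof -
  have M: "M \<in> carrier_mat N N" and inv: "invertible_mat M"
    using assms by (auto simp: nonsingular_def)
  from inv obtain K where K: "inverts_mat M K" "inverts_mat K M"
    unfolding invertible_mat_def by blast
  have "dim_row K = N" "dim_col K = N"
    using K M unfolding inverts_mat_def
    by (metis carrier_matD(1,2) index_mult_mat(2,3) index_one_mat(2,3))+
  then show ?thesis
    using that[of K] K M unfolding inverts_mat_def by auto
qed

text \<open>A left inverse of a square matrix is also a right inverse. This rules out the
  \<open>None\<close> result of \<open>mat_inverse\<close>, and any result \<open>L\<close> equals
  \<open>K\<close> because \<open>L = L * (M * K) = K\<close>.\<close>

lemma inv_mat_eqI:
  assumes M: "M \<in> carrier_mat N N" and K: "K \<in> carrier_mat N N" and KM: "K * M = 1\<^sub>m N"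
  shows "inv_mat M = K"
proof -
  have MK: "M * K = 1\<^sub>m N" by (rule mat_mult_left_right_inverse[OF K M KM])
  show ?thesis
  proof (cases "mat_inverse M")
    case None
    from mat_inverse(1)[OF M None, of undefined] M K KM MK show ?thesis
      by (auto simp: Units_def ring_mat_simps)
  next
    case (Some L)
    then have L: "L \<in> carrier_mat N N" "L * M = 1\<^sub>m N" using mat_inverse(2)[OF M Some] by auto
    have "L = L * (M * K)" using L MK by simp
    also have "\<dots> = K" using L M K by (simp flip: assoc_mult_mat)
    finally show ?thesis by (simp add: inv_mat_def Some)
  qed
qed

lemma nonsingular_mult_cancel_zero:
  assumes a: "nonsingular N a" and c: "nonsingular N c" and M: "M \<in> carrier_mat N N"
    and z: "a * M * c = 0\<^sub>m N N"
  shows "M = 0\<^sub>m N N"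
proof -
  obtain a' where a': "a' \<in> carrier_mat N N" "a' * a = 1\<^sub>m N" using nonsingular_inverse[OF a] .
  obtain c' where c': "c' \<in> carrier_mat N N" "c * c' = 1\<^sub>m N" using nonsingular_inverse[OF c] .
  note ca = nonsingular_carrier[OF a] nonsingular_carrier[OF c]
  have "M = (a' * a) * M * (c * c')" using a' c' M by simp
  also have "\<dots> = a' * (a * M * c) * c'" using a'(1) c'(1) ca M
    by (simp add: assoc_mult_mat[of _ N N _ N _ N])
  also have "\<dots> = 0\<^sub>m N N" using z a' c' by simp
  finally show ?thesis .
qed

section \<open>Casoratians of left and right recurrences\<close>

text \<open>The coefficients act from the left, while \<open>r\<close> and \<open>g\<close> are
  fixed factors on the right, so the common recurrence of \<open>v\<close> and \<open>q\<close>
  passes to the combination. It yields the recurrence of \<open>w\<close> in its first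
  index.\<close>

lemma recurrence_casoratian_left:
  fixes a c X :: "complex mat"
  assumes car: "a \<in> carrier_mat N N" "c \<in> carrier_mat N N" "X \<in> carrier_mat N N"
    "v\<^sub>0 \<in> carrier_mat N N" "v\<^sub>1 \<in> carrier_mat N N" "v\<^sub>2 \<in> carrier_mat N N"
    "q\<^sub>0 \<in> carrier_mat N N" "q\<^sub>1 \<in> carrier_mat N N" "q\<^sub>2 \<in> carrier_mat N N"
    "g \<in> carrier_mat N N" "r \<in> carrier_mat N N"
    and v: "a * v\<^sub>2 + c * v\<^sub>0 = X * v\<^sub>1" and q: "a * q\<^sub>2 + c * q\<^sub>0 = X * q\<^sub>1"
  shows "a * (v\<^sub>2 * r - q\<^sub>2 * g) + c * (v\<^sub>0 * r - q\<^sub>0 * g) = X * (v\<^sub>1 * r - q\<^sub>1 * g)"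
proof -
  have "X * (v\<^sub>1 * r - q\<^sub>1 * g) = (a * v\<^sub>2 + c * v\<^sub>0) * r - (a * q\<^sub>2 + c * q\<^sub>0) * g"
    unfolding v q using car
    by (simp add: mult_minus_distrib_mat[of _ N N _ N] assoc_mult_mat[of _ N N _ N _ N])
  also have "\<dots> = (a * (v\<^sub>2 * r) + c * (v\<^sub>0 * r)) - (a * (q\<^sub>2 * g) + c * (q\<^sub>0 * g))"
    using car by (simp add: add_mult_distrib_mat[of _ N N _ _ N] assoc_mult_mat[of _ N N _ N _ N])
  also have "\<dots> = (a * (v\<^sub>2 * r) - a * (q\<^sub>2 * g)) + (c * (v\<^sub>0 * r) - c * (q\<^sub>0 * g))"
    using car by (intro eq_matI) auto
  finally show ?thesis
    using car by (simp add: mult_minus_distrib_mat[of _ N N _ N])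
qed

text \<open>Mirror image of the previous lemma: the coefficients act from the right and the fixed
  factors \<open>v\<close> and \<open>q\<close> stand on the left, which yields the recurrence of
  \<open>w\<close> in its second index.\<close>

lemma recurrence_casoratian_right:
  fixes a c X :: "complex mat"
  assumes car: "a \<in> carrier_mat N N" "c \<in> carrier_mat N N" "X \<in> carrier_mat N N"
    "r\<^sub>0 \<in> carrier_mat N N" "r\<^sub>1 \<in> carrier_mat N N" "r\<^sub>2 \<in> carrier_mat N N"
    "g\<^sub>0 \<in> carrier_mat N N" "g\<^sub>1 \<in> carrier_mat N N" "g\<^sub>2 \<in> carrier_mat N N"
    "q \<in> carrier_mat N N" "v \<in> carrier_mat N N"
    and r: "r\<^sub>0 * a + r\<^sub>2 * c = r\<^sub>1 * X" and g: "g\<^sub>0 * a + g\<^sub>2 * c = g\<^sub>1 * X"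
  shows "(v * r\<^sub>0 - q * g\<^sub>0) * a + (v * r\<^sub>2 - q * g\<^sub>2) * c = (v * r\<^sub>1 - q * g\<^sub>1) * X"
proof -
  have "(v * r\<^sub>1 - q * g\<^sub>1) * X = v * (r\<^sub>0 * a + r\<^sub>2 * c) - q * (g\<^sub>0 * a + g\<^sub>2 * c)"
    unfolding r g using car
    by (simp add: minus_mult_distrib_mat[of _ N N _ _ N] assoc_mult_mat[of _ N N _ N _ N])
  also have "\<dots> = (v * r\<^sub>0 * a + v * r\<^sub>2 * c) - (q * g\<^sub>0 * a + q * g\<^sub>2 * c)"
    using car by (simp add: mult_add_distrib_mat[of _ N N _ N] assoc_mult_mat[of _ N N _ N _ N])
  also have "\<dots> = (v * r\<^sub>0 * a - q * g\<^sub>0 * a) + (v * r\<^sub>2 * c - q * g\<^sub>2 * c)"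
    using car by (intro eq_matI) auto
  finally show ?thesis
    using car by (simp add: minus_mult_distrib_mat[of _ N N _ _ N])
qed

text \<open>Index \<open>n\<close> stands for polynomial index n - 1, hence the shifts between
  \<open>a\<close> and \<open>c\<close>. The recurrences have order two, so the invariant carries
  two consecutive diagonal zeros: the newer one gives the next off-diagonal entries, the older one
  is used to expand \<open>w n (n + 2)\<close>.\<close>

lemma two_sided_recurrence:
  fixes w :: "nat \<Rightarrow> nat \<Rightarrow> complex mat" and a c X :: "nat \<Rightarrow> complex mat"
  assumes w: "\<And>s t. w s t \<in> carrier_mat N N"
    and a: "\<And>n. nonsingular N (a n)" and c: "\<And>n. nonsingular N (c n)"
    and X: "\<And>n. X n \<in> carrier_mat N N"
    and left: "\<And>n t. a (Suc n) * w (Suc (Suc n)) t + c n * w n t = X n * w (Suc n) t"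
    and right: "\<And>n s. w s n * a n + w s (Suc (Suc n)) * c (Suc n) = w s (Suc n) * X n"
    and init: "w 0 0 = 0\<^sub>m N N" "w 1 1 = 0\<^sub>m N N"
      "c 0 * w 0 1 = 1\<^sub>m N" "w 1 0 * a 0 = - 1\<^sub>m N"
  shows "w n n = 0\<^sub>m N N \<and> w (Suc n) (Suc n) = 0\<^sub>m N N \<and>
    c n * w n (Suc n) = 1\<^sub>m N \<and> w (Suc n) n * a n = - 1\<^sub>m N"
proof (induction n)
  case 0
  then show ?case using init by simp
next
  case (Suc n)
  note ac = nonsingular_carrier[OF a] nonsingular_carrier[OF c]
  note car = ac w X
  let ?m = "Suc n" and ?k = "Suc (Suc n)"
  have neg: "P = - 1\<^sub>m N" if "P + 1\<^sub>m N = 0\<^sub>m N N" "P \<in> carrier_mat N N" for P :: "complex mat"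
  proof (rule eq_matI)
    fix i j assume "i < dim_row (- 1\<^sub>m N :: complex mat)" "j < dim_col (- 1\<^sub>m N :: complex mat)"
    then have ij: "i < N" "j < N" by auto
    then have "(P + 1\<^sub>m N) $$ (i, j) = 0" using that by simp
    then show "P $$ (i, j) = (- 1\<^sub>m N :: complex mat) $$ (i, j)"
      using ij that(2) by (simp add: eq_neg_iff_add_eq_0 split: if_splits)
  qed (use that in auto)
  have pos: "P = 1\<^sub>m N" if "- 1\<^sub>m N + P = 0\<^sub>m N N" "P \<in> carrier_mat N N" for P :: "complex mat"
  proof (rule eq_matI)
    fix i j assume "i < dim_row (1\<^sub>m N :: complex mat)" "j < dim_col (1\<^sub>m N :: complex mat)"
    then have ij: "i < N" "j < N" by auto
    then have "(- 1\<^sub>m N + P) $$ (i, j) = 0" using that by simp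
    then show "P $$ (i, j) = (1\<^sub>m N :: complex mat) $$ (i, j)"
      using ij that(2) by (simp split: if_splits)
  qed (use that in auto)
  from Suc have IH: "w n n = 0\<^sub>m N N" "w ?m ?m = 0\<^sub>m N N" "c n * w n ?m = 1\<^sub>m N"
    "w ?m n * a n = - 1\<^sub>m N" by auto
  \<comment> \<open>In \<open>A\<close> and \<open>C\<close> the right-hand side of the recurrence
    has the factor \<open>w ?m ?m\<close>, which vanishes, so the two products on the left are
    negatives of each other.\<close>
  have A: "a ?m * w ?k ?m = - 1\<^sub>m N"
    using left[of n ?m] IH car mult_carrier_mat[OF ac(1) w]
    by (intro neg) (auto simp: right_mult_zero_mat[of _ N N])
  have C: "w ?m ?k * c ?m = 1\<^sub>m N"
    using right[of ?m n] IH car mult_carrier_mat[OF w ac(2)]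
    by (intro pos) (auto simp: left_mult_zero_mat[of _ N N])
  \<comment> \<open>The term with \<open>w n n\<close> has dropped out of the right recurrence.
    Multiplication by \<open>c n\<close> from the left then turns \<open>w n ?m\<close> into the
    identity and leaves \<open>X n\<close>.\<close>
  have "w n ?k * c ?m = w n ?m * X n"
    using right[of n n] IH(1) left_mult_zero_mat[OF ac(1)[of n]]
      left_add_zero_mat[OF mult_carrier_mat[OF w ac(2)]] by simp
  then have "c n * w n ?k * c ?m = (c n * w n ?m) * X n"
    using car by (simp add: assoc_mult_mat[of _ N N _ N _ N])
  then have D: "c n * w n ?k * c ?m = X n"
    unfolding IH(3) left_mult_one_mat[OF X] .
  \<comment> \<open>This is the left recurrence in column \<open>?k\<close>, multiplied by
    \<open>c ?m\<close> from the right. By \<open>C\<close> the right-hand side is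
    \<open>X n\<close>, and by \<open>D\<close> so is the second summand on the left; what remains
    is the sandwiched diagonal entry.\<close>
  have "(a ?m * w ?k ?k + c n * w n ?k) * c ?m = X n * (w ?m ?k * c ?m)"
    unfolding left by (rule assoc_mult_mat[OF X w ac(2)])
  then have F: "a ?m * w ?k ?k * c ?m + X n = X n"
    using add_mult_distrib_mat[OF mult_carrier_mat[OF ac(1) w] mult_carrier_mat[OF ac(2) w] ac(2)] C D
      right_mult_one_mat[OF X] by simp
  have "a ?m * w ?k ?k * c ?m = 0\<^sub>m N N"
  proof (rule eq_matI)
    fix i j assume "i < dim_row (0\<^sub>m N N :: complex mat)" "j < dim_col (0\<^sub>m N N :: complex mat)"
    then have ij: "i < N" "j < N" by auto
    have "(a ?m * w ?k ?k * c ?m + X n) $$ (i, j) = X n $$ (i, j)" using F by simp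
    then show "(a ?m * w ?k ?k * c ?m) $$ (i, j) = (0\<^sub>m N N :: complex mat) $$ (i, j)"
      using ij carrier_matD[OF X[of n]] by (simp del: index_mult_mat(1))
  qed (use carrier_matD[OF ac(1)] carrier_matD[OF ac(2)] in auto)
  then have E: "w ?k ?k = 0\<^sub>m N N"
    by (rule nonsingular_mult_cancel_zero[OF a c w])
  \<comment> \<open>The invariant has the factors in the opposite order from \<open>C\<close> and
    \<open>A\<close>; one-sided inverses of square matrices are two-sided.\<close>
  have "c ?m * w ?m ?k = 1\<^sub>m N"
    by (rule mat_mult_left_right_inverse[OF w ac(2) C])
  moreover have "w ?k ?m * a ?m = - 1\<^sub>m N"
  proof -
    have "a ?m * (- w ?k ?m) = 1\<^sub>m N"
      using A carrier_matD[OF ac(1)] carrier_matD[OF w] by simp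
    then have "(- w ?k ?m) * a ?m = 1\<^sub>m N"
      by (rule mat_mult_left_right_inverse[OF ac(1) uminus_carrier_mat[OF w]])
    then have "- (w ?k ?m * a ?m) = 1\<^sub>m N"
      using carrier_matD[OF ac(1)] carrier_matD[OF w] by simp
    from this[symmetric] show ?thesis by simp
  qed
  ultimately show ?case using IH E by simp
qed

text \<open>Moves the middle term across, so that the three-term recurrence has the single
  coefficient x - \<open>L\<close> on one side. The two forms serve coefficients acting from the
  left and from the right.\<close>

lemma recurrence_collect:
  fixes P R S L :: "complex mat"
  assumes car: "P \<in> carrier_mat N N" "R \<in> carrier_mat N N" "S \<in> carrier_mat N N" "L \<in> carrier_mat N N"
  shows "x \<cdot>\<^sub>m P = R + L * P + S \<Longrightarrow> R + S = (x \<cdot>\<^sub>m 1\<^sub>m N - L) * P"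
    and "x \<cdot>\<^sub>m P = R + P * L + S \<Longrightarrow> R + S = P * (x \<cdot>\<^sub>m 1\<^sub>m N - L)"
proof -
  have solve: "R + S = x \<cdot>\<^sub>m P - T" if "x \<cdot>\<^sub>m P = R + T + S" "T \<in> carrier_mat N N" for T
    unfolding that(1) using car that(2) by (intro eq_matI) auto
  have "(x \<cdot>\<^sub>m 1\<^sub>m N - L) * P = x \<cdot>\<^sub>m P - L * P"
    using car by (simp add: minus_mult_distrib_mat[of _ N N] mult_smult_assoc_mat[of _ N N _ N])
  with solve[of "L * P"] car mult_carrier_mat[of L N N P N]
  show "x \<cdot>\<^sub>m P = R + L * P + S \<Longrightarrow> R + S = (x \<cdot>\<^sub>m 1\<^sub>m N - L) * P" by simp
  have "P * (x \<cdot>\<^sub>m 1\<^sub>m N - L) = x \<cdot>\<^sub>m P - P * L"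
    using car by (simp add: mult_minus_distrib_mat[of _ N N _ N] mult_smult_distrib[of _ N N _ N])
  with solve[of "P * L"] car mult_carrier_mat[of P N N L N]
  show "x \<cdot>\<^sub>m P = R + P * L + S \<Longrightarrow> R + S = P * (x \<cdot>\<^sub>m 1\<^sub>m N - L)" by simp
qed

section \<open>Recurrences for the associated polynomials\<close>

lemma complex_integrable_0 [simp]: "complex_integrable \<mu> (\<lambda>_. 0)"
  by (simp add: complex_integrable_def signed_integrable_def)

lemma complex_integral_0 [simp]: "complex_integral \<mu> (\<lambda>_. 0) = 0"
  by (simp add: complex_integral_def signed_integral_def)

lemma complex_integrable_add:
  "complex_integrable \<mu> f \<Longrightarrow> complex_integrable \<mu> g \<Longrightarrow> complex_integrable \<mu> (\<lambda>y. f y + g y)"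
  by (simp add: complex_integrable_def signed_integrable_def)

lemma complex_integral_add:
  "complex_integrable \<mu> f \<Longrightarrow> complex_integrable \<mu> g \<Longrightarrow>
    complex_integral \<mu> (\<lambda>y. f y + g y) = complex_integral \<mu> f + complex_integral \<mu> g"
  by (simp add: complex_integrable_def signed_integrable_def complex_integral_def
      signed_integral_def algebra_simps)

lemma complex_integrable_cmult:
  "complex_integrable \<mu> f \<Longrightarrow> complex_integrable \<mu> (\<lambda>y. c * f y)"
  by (simp add: complex_integrable_def signed_integrable_def)

lemma complex_integral_cmult:
  "complex_integral \<mu> (\<lambda>y. c * f y) = c * complex_integral \<mu> f"
  by (simp add: complex_integral_def signed_integral_def algebra_simps)

definition finite_moments :: "(real set \<Rightarrow> complex) \<Rightarrow> bool" where
  "finite_moments \<mu> \<longleftrightarrow> (\<forall>n. complex_integrable \<mu> (\<lambda>x. of_real x ^ n))"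

lemma complex_integrable_poly:
  assumes "finite_moments \<mu>"
  shows "complex_integrable \<mu> (\<lambda>y. poly p (of_real y))"
proof -
  have "complex_integrable \<mu> (\<lambda>y. \<Sum>i\<in>I. coeff p i * of_real y ^ i)" if "finite I" for I
    using that
  proof induction
    case (insert i I)
    then show ?case
      using assms by (simp add: finite_moments_def complex_integrable_add complex_integrable_cmult)
  qed simp
  then show ?thesis by (simp add: poly_altdef)
qed

section \<open>Difference quotients and their integrals\<close>

text \<open>Synthetic division gives p(y) = p(x) + (y - x) d(y), so d is the quotient off the
  diagonal; differentiating at y = x gives p'(x) = d(x), the value on the diagonal. Being polynomial
  in y, the quotient is integrable once all moments are finite.\<close>

lemma diff_quotient_eq_poly:
  obtains d where "\<And>y. diff_quotient p x y = poly d y"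
proof
  define d where "d = synthetic_div p x"
  have p: "p = [:poly p x:] + [:- x, 1:] * d"
    using synthetic_div_correct'[of x p] unfolding d_def by (metis add.commute)
  show "diff_quotient p x y = poly d y" for y
  proof (cases "x = y")
    case True
    have "poly (pderiv p) x = poly (pderiv ([:poly p x:] + [:- x, 1:] * d)) x"
      using p by simp
    also have "\<dots> = poly d x"
      by (simp only: pderiv_add pderiv_mult) (simp add: pderiv_pCons)
    finally have "poly (pderiv p) x = poly d x" .
    with True show ?thesis by (simp add: diff_quotient_def)
  next
    case False
    have "poly p y = poly p x + (y - x) * poly d y"
      by (subst p) (simp add: algebra_simps)
    with False show ?thesis by (simp add: diff_quotient_def field_simps)
  qed
qed

lemma diff_quotient_0 [simp]: "diff_quotient 0 x y = 0"
  by (simp add: diff_quotient_def)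

lemma diff_quotient_1 [simp]: "diff_quotient 1 x y = 0"
  by (simp add: diff_quotient_def)

lemma diff_quotient_add:
  "diff_quotient (p + q) x y = diff_quotient p x y + diff_quotient q x y"
  by (simp add: diff_quotient_def pderiv_add diff_divide_distrib add_divide_distrib)

lemma diff_quotient_smult: "diff_quotient (smult c p) x y = c * diff_quotient p x y"
  by (simp add: diff_quotient_def pderiv_smult algebra_simps)

text \<open>Here \<open>pCons 0 p\<close> is t p(t), and x p(x) - y p(y) = x (p(x) - p(y)) + (x - y)
  p(y); on the diagonal this becomes the product rule. The extra p(y) is the source of the
  inhomogeneous term in the associated recurrences.\<close>

lemma diff_quotient_pCons_0:
  "diff_quotient (pCons 0 p) x y = x * diff_quotient p x y + poly p y"
  by (simp add: diff_quotient_def pderiv_pCons field_simps)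

text \<open>For fixed x and a measure with finite moments this is a linear functional of the
  polynomial. A recurrence between polynomials is carried to the associated ones by applying it
  entrywise.\<close>

definition quotient_integral :: "(real set \<Rightarrow> complex) \<Rightarrow> complex \<Rightarrow> complex poly \<Rightarrow> complex" where
  "quotient_integral \<mu> x p = complex_integral \<mu> (\<lambda>y. diff_quotient p x (of_real y))"

lemma complex_integrable_diff_quotient:
  assumes "finite_moments \<mu>"
  shows "complex_integrable \<mu> (\<lambda>y. diff_quotient p x (of_real y))"
proof -
  obtain d where "\<And>y. diff_quotient p x y = poly d y"
    using diff_quotient_eq_poly[of p x] by blast
  then show ?thesis using complex_integrable_poly[OF assms, of d] by simp
qed

context
  fixes \<mu> :: "real set \<Rightarrow> complex"
  assumes fin: "finite_moments \<mu>"
begin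

lemma quotient_integral_0 [simp]: "quotient_integral \<mu> x 0 = 0"
  by (simp add: quotient_integral_def)

lemma quotient_integral_add:
  "quotient_integral \<mu> x (p + q) = quotient_integral \<mu> x p + quotient_integral \<mu> x q"
  using fin by (simp add: quotient_integral_def diff_quotient_add complex_integral_add
      complex_integrable_diff_quotient)

lemma quotient_integral_smult: "quotient_integral \<mu> x (smult c p) = c * quotient_integral \<mu> x p"
  by (simp add: quotient_integral_def diff_quotient_smult complex_integral_cmult)

lemma quotient_integral_sum:
  "finite I \<Longrightarrow> quotient_integral \<mu> x (\<Sum>i\<in>I. p i) = (\<Sum>i\<in>I. quotient_integral \<mu> x (p i))"
  by (induction I rule: finite_induct) (simp_all add: quotient_integral_add)

lemma quotient_integral_pCons_0:
  "quotient_integral \<mu> x (pCons 0 p)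
    = x * quotient_integral \<mu> x p + complex_integral \<mu> (\<lambda>y. poly p (of_real y))"
  using fin by (simp add: quotient_integral_def diff_quotient_pCons_0 complex_integral_add
      complex_integral_cmult complex_integrable_cmult complex_integrable_diff_quotient
      complex_integrable_poly)

end

section \<open>Left associated matrix polynomials\<close>

lemma matrix_integral_carrier [simp]: "matrix_integral N W F H \<in> carrier_mat N N"
  by (simp add: matrix_integral_def)

text \<open>Takes a single matrix polynomial instead of a sequence with an index, so that it applies
  also to \<open>prev N V n\<close> and to transposes.\<close>

definition associated ::
  "nat \<Rightarrow> measure_matrix \<Rightarrow> complex poly mat \<Rightarrow> complex \<Rightarrow> complex mat" where
  "associated N W P x = matrix_integral N W (\<lambda>y. diff_quotient_mat P x (of_real y)) (\<lambda>_. 1\<^sub>m N)"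

lemma associated_carrier [simp]: "associated N W P x \<in> carrier_mat N N"
  by (simp add: associated_def matrix_integral_def)

lemma matrix_integral_one_right:
  assumes "i < N" "j < N"
  shows "matrix_integral N W F (\<lambda>_. 1\<^sub>m N) $$ (i, j)
    = (\<Sum>k<N. complex_integral (W k j) (\<lambda>y. F y $$ (i, k)))"
proof -
  have "(\<Sum>l<N. complex_integral (W k l) (\<lambda>y. F y $$ (i, k) * 1\<^sub>m N $$ (l, j)))
      = complex_integral (W k j) (\<lambda>y. F y $$ (i, k))" for k
  proof -
    have "(\<Sum>l<N. complex_integral (W k l) (\<lambda>y. F y $$ (i, k) * 1\<^sub>m N $$ (l, j)))
        = (\<Sum>l<N. if l = j then complex_integral (W k l) (\<lambda>y. F y $$ (i, k)) else 0)"
      using assms by (intro sum.cong) auto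
    then show ?thesis using assms by simp
  qed
  then show ?thesis using assms by (simp add: matrix_integral_def)
qed

lemma associated_index:
  assumes "P \<in> carrier_mat N N" "i < N" "j < N"
  shows "associated N W P x $$ (i, j) = (\<Sum>k<N. quotient_integral (W k j) x (P $$ (i, k)))"
  using assms by (auto simp: associated_def matrix_integral_one_right quotient_integral_def
      diff_quotient_mat_def intro!: sum.cong)

lemma associated_zero [simp]: "associated N W (0\<^sub>m N N) x = 0\<^sub>m N N"
  by (rule eq_matI) (auto simp: associated_index[OF zero_carrier_mat] quotient_integral_def
      carrier_matD[OF associated_carrier])

lemma associated_one [simp]: "associated N W (1\<^sub>m N) x = 0\<^sub>m N N"
  by (rule eq_matI) (auto simp: associated_index[OF one_carrier_mat] quotient_integral_def
      carrier_matD[OF associated_carrier] intro!: sum.neutral)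

text \<open>A constant left factor passes through the integral, since the polynomial stands to the
  left of dW. The polynomial under the functional is the entry of the product of \<open>M\<close>
  and \<open>P\<close> that \<open>mult_eval_mat_index\<close> evaluates.\<close>

lemma mult_associated_index:
  assumes fin: "\<And>k. k < N \<Longrightarrow> finite_moments (W k j)"
    and M: "M \<in> carrier_mat N N" and P: "P \<in> carrier_mat N N" and ij: "i < N" "j < N"
  shows "(M * associated N W P x) $$ (i, j)
    = (\<Sum>k<N. quotient_integral (W k j) x (\<Sum>m<N. smult (M $$ (i, m)) (P $$ (m, k))))"
proof -
  have "(M * associated N W P x) $$ (i, j) = (\<Sum>m<N. M $$ (i, m) * associated N W P x $$ (m, j))"
    using M ij carrier_matD[OF associated_carrier[of N W P x]]
    by (simp add: scalar_prod_def lessThan_atLeast0)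
  also have "\<dots> = (\<Sum>m<N. \<Sum>k<N. M $$ (i, m) * quotient_integral (W k j) x (P $$ (m, k)))"
    using P ij by (simp add: associated_index sum_distrib_left)
  also have "\<dots> = (\<Sum>k<N. \<Sum>m<N. M $$ (i, m) * quotient_integral (W k j) x (P $$ (m, k)))"
    by (rule sum.swap)
  also have "\<dots> = (\<Sum>k<N. quotient_integral (W k j) x (\<Sum>m<N. smult (M $$ (i, m)) (P $$ (m, k))))"
    using fin by (intro sum.cong) (auto simp: quotient_integral_sum quotient_integral_smult)
  finally show ?thesis .
qed

lemma mult_eval_mat_index:
  assumes "M \<in> carrier_mat N N" "P \<in> carrier_mat N N" "i < N" "k < N"
  shows "(M * eval_mat P y) $$ (i, k) = poly (\<Sum>m<N. smult (M $$ (i, m)) (P $$ (m, k))) y"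
  using assms by (simp add: eval_mat_def scalar_prod_def lessThan_atLeast0 poly_sum)

text \<open>The functional keeps the constant coefficients of the recurrence, and multiplication by
  the variable produces the additional integral of \<open>P\<close>, which biorthogonality evaluates
  later.\<close>

lemma associated_recurrence:
  assumes fin: "\<And>k l. k < N \<Longrightarrow> l < N \<Longrightarrow> finite_moments (W k l)"
    and P: "P \<in> carrier_mat N N" "P' \<in> carrier_mat N N" "P'' \<in> carrier_mat N N"
    and K: "K \<in> carrier_mat N N" "L \<in> carrier_mat N N" "M \<in> carrier_mat N N"
    and rec: "\<And>y. y \<cdot>\<^sub>m eval_mat P y = K * eval_mat P' y + L * eval_mat P y + M * eval_mat P'' y"
  shows "x \<cdot>\<^sub>m associated N W P x
      + matrix_integral N W (\<lambda>y. eval_mat P (of_real y)) (\<lambda>_. 1\<^sub>m N)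
    = K * associated N W P' x + L * associated N W P x + M * associated N W P'' x"
    (is "?lhs = ?rhs")
proof (rule eq_matI)
  fix i j assume "i < dim_row ?rhs" "j < dim_col ?rhs"
  then have ij: "i < N" "j < N"
    using K carrier_matD[OF associated_carrier[of N W P'' x]] by auto
  let ?S = "\<lambda>M P k. \<Sum>m<N. smult (M $$ (i, m)) (P $$ (m, k))"
  \<comment> \<open>The recurrence is given pointwise; agreement at every complex \<open>y\<close>
    makes it an identity of polynomials, to which the functional applies.\<close>
  have poly: "pCons 0 (P $$ (i, k)) = ?S K P' k + ?S L P k + ?S M P'' k" if k: "k < N" for k
  proof -
    have "poly (pCons 0 (P $$ (i, k))) y = poly (?S K P' k + ?S L P k + ?S M P'' k) y" for y
    proof -
      have "poly (pCons 0 (P $$ (i, k))) y = (y \<cdot>\<^sub>m eval_mat P y) $$ (i, k)"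
        using P ij k by (simp add: eval_mat_def)
      also have "\<dots> = (K * eval_mat P' y) $$ (i, k) + (L * eval_mat P y) $$ (i, k)
          + (M * eval_mat P'' y) $$ (i, k)"
        unfolding rec using P K ij k by (simp add: eval_mat_def del: index_mult_mat(1))
      finally show ?thesis using P K ij k by (simp add: mult_eval_mat_index del: index_mult_mat(1))
    qed
    then show ?thesis by (simp add: poly_eq_poly_eq_iff[symmetric] fun_eq_iff)
  qed
  have "?rhs $$ (i, j) = (K * associated N W P' x) $$ (i, j) + (L * associated N W P x) $$ (i, j)
      + (M * associated N W P'' x) $$ (i, j)"
    using K ij by (simp add: carrier_matD[OF associated_carrier] del: index_mult_mat(1))
  also have "\<dots> = (\<Sum>k<N. quotient_integral (W k j) x (?S K P' k + ?S L P k + ?S M P'' k))"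
    using P K ij fin
    by (simp add: mult_associated_index quotient_integral_add sum.distrib del: index_mult_mat(1))
  also have "\<dots> = (\<Sum>k<N. quotient_integral (W k j) x (pCons 0 (P $$ (i, k))))"
    by (intro sum.cong) (simp_all add: poly)
  also have "\<dots> = ?lhs $$ (i, j)"
  proof -
    have "(\<Sum>k<N. complex_integral (W k j) (\<lambda>y. eval_mat P (of_real y) $$ (i, k)))
        = (\<Sum>k<N. complex_integral (W k j) (\<lambda>y. poly (P $$ (i, k)) (of_real y)))"
      using P ij by (intro sum.cong) (auto simp: eval_mat_def)
    then show ?thesis using P ij fin
      by (simp add: quotient_integral_pCons_0 sum.distrib sum_distrib_left associated_index
          matrix_integral_one_right carrier_matD[OF associated_carrier]
          carrier_matD[OF matrix_integral_carrier])
  qed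
  finally show "?lhs $$ (i, j) = ?rhs $$ (i, j)" by simp
qed (use K in \<open>auto simp: matrix_integral_def carrier_matD[OF associated_carrier]\<close>)

section \<open>Right associated polynomials by transposition\<close>

definition swap_measure :: "measure_matrix \<Rightarrow> measure_matrix" where
  "swap_measure W i j = W j i"

text \<open>The entries are scalars and commute under the integral, so transposing only exchanges
  the two factors and the indices of the measures. Facts about \<open>associated\<close> thereby
  transfer to \<open>associated_right\<close>.\<close>

lemma transpose_matrix_integral:
  assumes "\<And>y. F y \<in> carrier_mat N N" "\<And>y. H y \<in> carrier_mat N N"
  shows "transpose_mat (matrix_integral N W F H)
    = matrix_integral N (swap_measure W) (\<lambda>y. transpose_mat (H y)) (\<lambda>y. transpose_mat (F y))"
proof (rule eq_matI)
  fix i j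
  let ?R = "matrix_integral N (swap_measure W) (\<lambda>y. transpose_mat (H y)) (\<lambda>y. transpose_mat (F y))"
  assume "i < dim_row ?R" "j < dim_col ?R"
  then have ij: "i < N" "j < N" by (auto simp: matrix_integral_def)
  have "transpose_mat (matrix_integral N W F H) $$ (i, j)
      = (\<Sum>k<N. \<Sum>l<N. complex_integral (W k l) (\<lambda>y. F y $$ (j, k) * H y $$ (l, i)))"
    using ij by (simp add: matrix_integral_def)
  also have "\<dots> = (\<Sum>l<N. \<Sum>k<N. complex_integral (W k l) (\<lambda>y. F y $$ (j, k) * H y $$ (l, i)))"
    by (rule sum.swap)
  also have "\<dots> = ?R $$ (i, j)"
    using ij carrier_matD[OF assms(1)] carrier_matD[OF assms(2)]
    by (auto simp: matrix_integral_def swap_measure_def mult.commute intro!: sum.cong)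
  finally show "transpose_mat (matrix_integral N W F H) $$ (i, j) = ?R $$ (i, j)" .
qed (auto simp: matrix_integral_def)

lemma eval_mat_carrier [simp]: "eval_mat P x \<in> carrier_mat n m \<longleftrightarrow> P \<in> carrier_mat n m"
  by (auto simp: eval_mat_def)

lemma eval_mat_one [simp]: "eval_mat (1\<^sub>m N) x = 1\<^sub>m N"
  by (rule eq_matI) (auto simp: eval_mat_def)

lemma eval_mat_zero [simp]: "eval_mat (0\<^sub>m N M) x = 0\<^sub>m N M"
  by (rule eq_matI) (auto simp: eval_mat_def)

lemma eval_mat_transpose: "eval_mat (transpose_mat P) x = transpose_mat (eval_mat P x)"
  by (rule eq_matI) (auto simp: eval_mat_def)

lemma diff_quotient_mat_carrier [simp]:
  "diff_quotient_mat P x y \<in> carrier_mat n m \<longleftrightarrow> P \<in> carrier_mat n m"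
  by (auto simp: diff_quotient_mat_def)

lemma diff_quotient_mat_transpose:
  "diff_quotient_mat (transpose_mat P) x y = transpose_mat (diff_quotient_mat P x y)"
  by (rule eq_matI) (auto simp: diff_quotient_mat_def)

lemma transpose_smult_mat: "transpose_mat (k \<cdot>\<^sub>m A) = k \<cdot>\<^sub>m transpose_mat A"
  by (rule eq_matI) auto

definition associated_right ::
  "nat \<Rightarrow> measure_matrix \<Rightarrow> complex poly mat \<Rightarrow> complex \<Rightarrow> complex mat" where
  "associated_right N W P x =
    matrix_integral N W (\<lambda>_. 1\<^sub>m N) (\<lambda>y. diff_quotient_mat P x (of_real y))"

lemma associated_right_carrier [simp]: "associated_right N W P x \<in> carrier_mat N N"
  by (simp add: associated_right_def matrix_integral_def)

lemma transpose_associated_right: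
  assumes "P \<in> carrier_mat N N"
  shows "transpose_mat (associated_right N W P x) = associated N (swap_measure W) (transpose_mat P) x"
  using assms unfolding associated_right_def associated_def
  by (subst transpose_matrix_integral) (simp_all add: diff_quotient_mat_transpose)

lemma associated_right_zero [simp]: "associated_right N W (0\<^sub>m N N) x = 0\<^sub>m N N"
  using transpose_associated_right[of "0\<^sub>m N N" N W x]
  by (simp flip: transpose_mat_eq[of "associated_right _ _ _ _"])

lemma associated_right_one [simp]: "associated_right N W (1\<^sub>m N) x = 0\<^sub>m N N"
  using transpose_associated_right[of "1\<^sub>m N" N W x]
  by (simp flip: transpose_mat_eq[of "associated_right _ _ _ _"])

text \<open>Transposition moves the coefficients to the left and swaps the measures, so
  \<open>associated_recurrence\<close> applies; transposing back gives the claim.\<close>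

lemma associated_right_recurrence:
  assumes fin: "\<And>k l. k < N \<Longrightarrow> l < N \<Longrightarrow> finite_moments (W k l)"
    and P: "P \<in> carrier_mat N N" "P' \<in> carrier_mat N N" "P'' \<in> carrier_mat N N"
    and K: "K \<in> carrier_mat N N" "L \<in> carrier_mat N N" "M \<in> carrier_mat N N"
    and rec: "\<And>y. y \<cdot>\<^sub>m eval_mat P y = eval_mat P' y * K + eval_mat P y * L + eval_mat P'' y * M"
  shows "x \<cdot>\<^sub>m associated_right N W P x
      + matrix_integral N W (\<lambda>_. 1\<^sub>m N) (\<lambda>y. eval_mat P (of_real y))
    = associated_right N W P' x * K + associated_right N W P x * L + associated_right N W P'' x * M"
    (is "?lhs = ?rhs")
proof -
  note tr = transpose_add[of _ N N] transpose_mult[of _ N N _ N] transpose_smult_mat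
    mult_carrier_mat[of _ N N _ N]
  have "transpose_mat ?lhs = x \<cdot>\<^sub>m associated N (swap_measure W) (transpose_mat P) x
      + matrix_integral N (swap_measure W) (\<lambda>y. eval_mat (transpose_mat P) (of_real y)) (\<lambda>_. 1\<^sub>m N)"
    using P transpose_matrix_integral[of "\<lambda>_. 1\<^sub>m N" N "\<lambda>y. eval_mat P (of_real y)" W]
    by (subst transpose_add[of _ N N])
      (auto simp: transpose_smult_mat transpose_associated_right eval_mat_transpose matrix_integral_def)
  also have "\<dots> = transpose_mat K * associated N (swap_measure W) (transpose_mat P') x
      + transpose_mat L * associated N (swap_measure W) (transpose_mat P) x
      + transpose_mat M * associated N (swap_measure W) (transpose_mat P'') x"
  proof (rule associated_recurrence)
    fix y
    have "y \<cdot>\<^sub>m eval_mat (transpose_mat P) y = transpose_mat (y \<cdot>\<^sub>m eval_mat P y)"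
      by (simp add: eval_mat_transpose transpose_smult_mat)
    also have "\<dots> = transpose_mat K * eval_mat (transpose_mat P') y
        + transpose_mat L * eval_mat (transpose_mat P) y
        + transpose_mat M * eval_mat (transpose_mat P'') y"
      unfolding rec using P K by (simp add: tr eval_mat_transpose)
    finally show "y \<cdot>\<^sub>m eval_mat (transpose_mat P) y
      = transpose_mat K * eval_mat (transpose_mat P') y
        + transpose_mat L * eval_mat (transpose_mat P) y
        + transpose_mat M * eval_mat (transpose_mat P'') y" .
  qed (use fin P K in \<open>auto simp: swap_measure_def\<close>)
  also have "\<dots> = transpose_mat ?rhs"
    using P K by (simp add: tr transpose_associated_right)
  finally show ?thesis by (simp only: transpose_mat_eq)
qed

section \<open>The Casoratian identities for biorthogonal polynomials\<close>

theorem theorem4: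
  fixes N :: nat
    and W :: measure_matrix
    and V G :: "nat \<Rightarrow> complex poly mat"
    and A B C :: "nat \<Rightarrow> complex mat"
  assumes "N \<ge> 1"
    and "quasidefinite N W"
    and "moment N W 0 = 1\<^sub>m N"
    and "biorthogonal N W V G"
    and "V 0 = 1\<^sub>m N" and "G 0 = 1\<^sub>m N"
    and "\<And>n. nonsingular N (A n)"
    and "\<And>n. B n \<in> carrier_mat N N"
    and "\<And>n. C n \<in> carrier_mat N N" and "\<And>n. n \<ge> 1 \<Longrightarrow> nonsingular N (C n)"
    and "\<And>n x. x \<cdot>\<^sub>m eval_mat (V n) x =
           A n * eval_mat (V (n + 1)) x + B n * eval_mat (V n) x + C n * eval_mat (prev N V n) x"
    and "\<And>n x. x \<cdot>\<^sub>m eval_mat (G n) x =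
           eval_mat (prev N G n) x * A (n - 1) + eval_mat (G n) x * B n + eval_mat (G (n + 1)) x * C (n + 1)"
  shows "\<forall>n x.
      left_assoc N W V (n + 1) x * eval_mat (G n) x - eval_mat (V (n + 1)) x * right_assoc N W G n x
        = inv_mat (A n) \<and>
      eval_mat (V n) x * right_assoc N W G (n + 1) x - left_assoc N W V n x * eval_mat (G (n + 1)) x
        = inv_mat (C (n + 1))"
proof (intro allI)
  fix n :: nat and x :: complex
  note V0 = assms(5) and G0 = assms(6) and A = assms(7) and B = assms(8) and C = assms(9)
    and C1 = assms(10) and recV = assms(11) and recG = assms(12)
  note Ac = nonsingular_carrier[OF A]
  have fin: "finite_moments (W k l)" if "k < N" "l < N" for k l
    using assms(2) that by (simp add: quasidefinite_def finite_moments_def)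
  have V: "V m \<in> carrier_mat N N" and G: "G m \<in> carrier_mat N N" for m
    using assms(4) by (auto simp: biorthogonal_def)
  have prev: "prev N V m \<in> carrier_mat N N" "prev N G m \<in> carrier_mat N N" for m
    using V G by (auto simp: prev_def split: nat.split)
  have orth: "matrix_integral N W (\<lambda>y. eval_mat (V k) (of_real y)) (\<lambda>y. eval_mat (G l) (of_real y))
      = (if k = l then 1\<^sub>m N else 0\<^sub>m N N)" for k l
    using assms(4) by (simp add: biorthogonal_def)
  define Q where "Q m = associated N W (V m) x" for m
  define R where "R m = associated_right N W (G m) x" for m
  have Qc: "Q m \<in> carrier_mat N N" and Rc: "R m \<in> carrier_mat N N" for m
    by (simp_all add: Q_def R_def)
  have Q0: "Q 0 = 0\<^sub>m N N" and R0: "R 0 = 0\<^sub>m N N"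
    by (simp_all add: Q_def R_def V0 G0)
  have recQ: "x \<cdot>\<^sub>m Q m + (if m = 0 then 1\<^sub>m N else 0\<^sub>m N N)
      = A m * Q (Suc m) + B m * Q m + C m * associated N W (prev N V m) x" for m
  proof -
    have "x \<cdot>\<^sub>m Q m + matrix_integral N W (\<lambda>y. eval_mat (V m) (of_real y)) (\<lambda>_. 1\<^sub>m N)
        = A m * associated N W (V (m + 1)) x + B m * Q m + C m * associated N W (prev N V m) x"
      unfolding Q_def by (rule associated_recurrence[OF fin V V prev(1) Ac B C recV])
    \<comment> \<open>As \<open>G 0\<close> is the identity, the integral of \<open>V m\<close> is
      its pairing with \<open>G 0\<close>.\<close>
    then show ?thesis using orth[of m 0] by (simp add: Q_def G0)
  qed
  have recR: "x \<cdot>\<^sub>m R m + (if m = 0 then 1\<^sub>m N else 0\<^sub>m N N)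
      = associated_right N W (prev N G m) x * A (m - 1) + R m * B m + R (Suc m) * C (Suc m)" for m
  proof -
    have "x \<cdot>\<^sub>m R m + matrix_integral N W (\<lambda>_. 1\<^sub>m N) (\<lambda>y. eval_mat (G m) (of_real y))
        = associated_right N W (prev N G m) x * A (m - 1) + R m * B m
          + associated_right N W (G (m + 1)) x * C (m + 1)"
      unfolding R_def by (rule associated_right_recurrence[OF fin G prev(2) G Ac B C recG])
    then show ?thesis using orth[of 0 m] by (simp add: R_def V0 eq_commute[of 0 m])
  qed

  text \<open>
    With index \<open>m\<close> standing for \<open>m - 1\<close> and the initial values \<open>- 1\<close> at index \<open>- 1\<close>, the
    recurrences of the associated polynomials lose their inhomogeneous term.
  \<close>
  define v where "v m = eval_mat (prev N V m) x" for m
  define g where "g m = eval_mat (prev N G m) x" for m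
  define q where "q m = (case m of 0 \<Rightarrow> - 1\<^sub>m N | Suc k \<Rightarrow> Q k)" for m
  define r where "r m = (case m of 0 \<Rightarrow> - 1\<^sub>m N | Suc k \<Rightarrow> R k)" for m
  \<comment> \<open>In terms of \<open>v\<close>, \<open>A m\<close> multiplies index m + 2 and
    \<open>C m\<close> index m, so \<open>a\<close> is shifted and \<open>c\<close> is not. The
    value 1 at index 0 lets the initial values -1 of \<open>q\<close> and \<open>r\<close> cancel
    the inhomogeneous terms.\<close>
  define a where "a m = (case m of 0 \<Rightarrow> 1\<^sub>m N | Suc k \<Rightarrow> A k)" for m
  define c where "c m = (if m = 0 then 1\<^sub>m N else C m)" for m
  define X where "X m = x \<cdot>\<^sub>m 1\<^sub>m N - B m" for m
  define w where "w s t = v s * r t - q s * g t" for s t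
  have v: "v m \<in> carrier_mat N N" and g: "g m \<in> carrier_mat N N" for m
    using prev by (simp_all add: v_def g_def)
  have q: "q m \<in> carrier_mat N N" and r: "r m \<in> carrier_mat N N" for m
    using Qc Rc by (simp_all add: q_def r_def split: nat.split)
  have X: "X m \<in> carrier_mat N N" for m
    using B by (simp add: X_def minus_carrier_mat)
  have one: "nonsingular N (1\<^sub>m N)"
    by (auto simp: nonsingular_def invertible_mat_def inverts_mat_def intro!: exI[of _ "1\<^sub>m N"])
  have a: "nonsingular N (a m)" and c: "nonsingular N (c m)" for m
    using A C1 one by (auto simp: a_def c_def split: nat.split)
  note ac = nonsingular_carrier[OF a] nonsingular_carrier[OF c]
  have one_minus_one: "1\<^sub>m N + - 1\<^sub>m N = (0\<^sub>m N N :: complex mat)"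
    "- 1\<^sub>m N + 1\<^sub>m N = (0\<^sub>m N N :: complex mat)"
    by (rule eq_matI; simp)+
  note mc = mult_carrier_mat[of _ N N _ N]

  have recv: "a (Suc m) * v (Suc (Suc m)) + c m * v m = X m * v (Suc m)" for m
  proof -
    have "A m * eval_mat (V (Suc m)) x + C m * v m = X m * eval_mat (V m) x"
      unfolding X_def using recV[of x m] V B C Ac v
      by (intro recurrence_collect(1)) (auto simp: v_def intro: mc)
    \<comment> \<open>At m = 0 the given \<open>C 0\<close> and the chosen \<open>c 0\<close> may
      differ, but both multiply \<open>v 0\<close>, which is zero.\<close>
    moreover have "C m * v m = c m * v m"
      using right_mult_zero_mat[OF C] by (cases m) (auto simp: c_def v_def prev_def)
    ultimately show ?thesis by (simp add: a_def v_def prev_def)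
  qed
  have recg: "g m * a m + g (Suc (Suc m)) * c (Suc m) = g (Suc m) * X m" for m
  proof -
    have "g m * A (m - 1) + eval_mat (G (Suc m)) x * C (Suc m) = eval_mat (G m) x * X m"
      unfolding X_def using recG[of x m] G B C Ac g
      by (intro recurrence_collect(2)) (auto simp: g_def intro: mc)
    \<comment> \<open>At m = 0 truncated subtraction makes \<open>A (m - 1)\<close> equal to
      \<open>A 0\<close>, whereas \<open>a 0\<close> is 1; both multiply \<open>g 0\<close>, which
      is zero.\<close>
    moreover have "g m * A (m - 1) = g m * a m"
      using left_mult_zero_mat[OF Ac] by (cases m) (auto simp: a_def g_def prev_def)
    ultimately show ?thesis by (simp add: c_def g_def prev_def)
  qed
  have recq: "a (Suc m) * q (Suc (Suc m)) + c m * q m = X m * q (Suc m)" for m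
  proof (cases m)
    case 0
    \<comment> \<open>The inhomogeneous term at index 0 is this identity matrix; adding
      \<open>c 0 * q 0\<close>, which is -1, cancels it.\<close>
    have "A 0 * Q (Suc 0) = 1\<^sub>m N"
      using recQ[of 0] Q0 C[of 0] B[of 0] Qc[of "Suc 0"] Ac[of 0] mc[OF Ac Qc, of 0 "Suc 0"]
      by (simp add: prev_def)
    then show ?thesis
      using X[of 0] by (simp add: 0 a_def c_def q_def Q0 one_minus_one)
  next
    case (Suc k)
    have "A m * Q (Suc m) + C m * Q k = X m * Q m"
      unfolding X_def using recQ[of m] Qc B C Ac Suc
      by (intro recurrence_collect(1)) (auto simp: prev_def Q_def intro: mc)
    then show ?thesis by (simp add: Suc a_def c_def q_def)
  qed
  have recr: "r m * a m + r (Suc (Suc m)) * c (Suc m) = r (Suc m) * X m" for m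
  proof (cases m)
    case 0
    have "R (Suc 0) * C (Suc 0) = 1\<^sub>m N"
      using recR[of 0] R0 C[of 0] B[of 0] Ac[of 0] mc[OF Rc C, of "Suc 0" "Suc 0"]
      by (simp add: prev_def)
    then show ?thesis
      using X[of 0] by (simp add: 0 a_def c_def r_def R0 one_minus_one)
  next
    case (Suc k)
    have "R k * A k + R (Suc m) * C (Suc m) = R m * X m"
      unfolding X_def using recR[of m] Rc B C Ac Suc
      by (intro recurrence_collect(2)) (auto simp: prev_def R_def intro: mc)
    then show ?thesis by (simp add: Suc a_def c_def r_def)
  qed
  have w: "w s t \<in> carrier_mat N N" for s t
    using v g q r by (auto simp: w_def intro!: minus_carrier_mat mc)
  have vg: "v 0 = 0\<^sub>m N N" "g 0 = 0\<^sub>m N N" "v 1 = 1\<^sub>m N" "g 1 = 1\<^sub>m N"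
    by (simp_all add: v_def g_def prev_def V0 G0)
  have qr: "q 0 = - 1\<^sub>m N" "r 0 = - 1\<^sub>m N" "q 1 = 0\<^sub>m N N" "r 1 = 0\<^sub>m N N"
    by (simp_all add: q_def r_def Q0 R0)
  have init: "w 0 0 = 0\<^sub>m N N" "w 1 1 = 0\<^sub>m N N" "w 0 1 = 1\<^sub>m N" "w 1 0 = - 1\<^sub>m N"
    unfolding w_def vg qr by (auto intro!: eq_matI)
  have w_inverse: "c m * w m (Suc m) = 1\<^sub>m N \<and> w (Suc m) m * a m = - 1\<^sub>m N" for m
  proof -
    have "a (Suc k) * w (Suc (Suc k)) t + c k * w k t = X k * w (Suc k) t" for k t
      unfolding w_def by (rule recurrence_casoratian_left) (use v g q r X ac recv recq in auto)
    moreover have "w s k * a k + w s (Suc (Suc k)) * c (Suc k) = w s (Suc k) * X k" for k s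
      unfolding w_def by (rule recurrence_casoratian_right) (use v g q r X ac recg recr in auto)
    ultimately show ?thesis
      using two_sided_recurrence[of w N a c X m] w a c X init
      by (simp add: a_def[of 0] c_def[of 0])
  qed
  have assoc: "left_assoc N W V m x = Q m" "right_assoc N W G m x = R m" for m
    by (simp_all add: left_assoc_def right_assoc_def Q_def R_def associated_def associated_right_def)
  have "inv_mat (A n) = Q (Suc n) * eval_mat (G n) x - eval_mat (V (Suc n)) x * R n"
  proof (rule inv_mat_eqI[OF Ac])
    let ?K = "Q (Suc n) * eval_mat (G n) x - eval_mat (V (Suc n)) x * R n"
    show "?K \<in> carrier_mat N N"
      using Qc Rc V G by (auto intro!: minus_carrier_mat mc)
    \<comment> \<open>Both indices of \<open>w\<close> are shifted by one. The minus sign matches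
      the -1 below the diagonal.\<close>
    have "?K = - w (Suc (Suc n)) (Suc n)"
      using Qc[of "Suc n"] Rc[of n] V[of "Suc n"] G[of n]
      by (intro eq_matI) (auto simp: w_def v_def g_def q_def r_def prev_def)
    then have "?K * A n = - (w (Suc (Suc n)) (Suc n) * a (Suc n))"
      using carrier_matD[OF w] carrier_matD[OF Ac] by (simp add: a_def)
    then show "?K * A n = 1\<^sub>m N" using w_inverse[of "Suc n"] by simp
  qed
  moreover have "inv_mat (C (Suc n)) = eval_mat (V n) x * R (Suc n) - Q n * eval_mat (G (Suc n)) x"
  proof (rule inv_mat_eqI[OF C])
    let ?K = "eval_mat (V n) x * R (Suc n) - Q n * eval_mat (G (Suc n)) x"
    show K: "?K \<in> carrier_mat N N"
      using Qc Rc V G by (auto intro!: minus_carrier_mat mc)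
    have "?K = w (Suc n) (Suc (Suc n))"
      by (simp add: w_def v_def g_def q_def r_def prev_def)
    then have "C (Suc n) * ?K = 1\<^sub>m N"
      using w_inverse[of "Suc n"] by (simp add: c_def)
    \<comment> \<open>\<open>w_inverse\<close> supplies a right inverse of \<open>C (Suc n)\<close>,
      whereas \<open>inv_mat_eqI\<close> asks for a left one.\<close>
    then show "?K * C (Suc n) = 1\<^sub>m N"
      by (rule mat_mult_left_right_inverse[OF C K])
  qed
  ultimately show "left_assoc N W V (n + 1) x * eval_mat (G n) x
        - eval_mat (V (n + 1)) x * right_assoc N W G n x = inv_mat (A n) \<and>
      eval_mat (V n) x * right_assoc N W G (n + 1) x
        - left_assoc N W V n x * eval_mat (G (n + 1)) x = inv_mat (C (n + 1))"
    by (simp add: assoc)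
qed

end
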